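(* Let $A$ and $A'$ be unimodular square matrices (of sizes $n\times n$ and $n'\times n'$) with non-negative integer entries, each having some power with strictly positive entries, and let $G_A$, $G_{A'}$ be the associated stationary $AF$-algebras. Let $p(x)\in\mathbb{Z}[x]$ be any polynomial with $p(0)=\pm 1$. If $G_A$ and $G_{A'}$ are strongly stably isomorphic, then the abelian groups $Ab_{p(x)}(G_A)=\mathbb{Z}^n/p(A)\mathbb{Z}^n$ and $Ab_{p(x)}(G_{A'})=\mathbb{Z}^{n'}/p(A')\mathbb{Z}^{n'}$ are isomorphic. That is, $Ab_{p(x)}(G_A)$ is an invariant of the strong stable isomorphism class of $G_A$.
   Context: A matrix is unimodular if its determinant is $\pm1$. For such an $A$ (size $n\times n$), $G_A$ denotes the $AF$-algebra given by the stationary (periodic) Bratteli diagram whose incidence matrix at every level is $A$. Its dimension group $(G_A,G_A^+)$ is the ordered group obtained as the direct limit $\mathbb{Z}^n\xrightarrow{A}\mathbb{Z}^n\xrightarrow{A}\mathbb{Z}^n\xrightarrow{A}\cdots$ with the positive cone coming from $\mathbb{Z}^n_{\ge 0}$. The shift automorphism $\sigma_A$ is the order-automorphism of $(G_A,G_A^+)$ induced by $A$ (equivalently, multiplication by the Perron–Frobenius eigenvalue $\lambda_A$ when $G_A$ is realized inside $\mathbb{R}$ via the Perron–Frobenius eigenvector). Two $C^*$-algebras $B,B'$ are stably isomorphic if $B\otimes\mathcal{K}\cong B'\otimes\mathcal{K}$, $\mathcal{K}$ the compact operators on a separable Hilbert space; for $AF$-algebras this is equivalent to order-isomorphism of their dimension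 groups. $G_A$ and $G_{A'}$ are strongly stably isomorphic if there is an order-isomorphism $\theta:(G_{A'},G_{A'}^+)\to(G_A,G_A^+)$ of dimension groups with $\sigma_A\circ\theta=\theta\circ\sigma_{A'}$ (conjugate shift automorphisms). *)

theory Defs
  imports
    "Jordan_Normal_Form.Determinant"
    "HOL-Algebra.Coset"
    "HOL-Computational_Algebra.Polynomial"
begin

definition unimodular :: "int mat \<Rightarrow> bool" where
  "unimodular A \<longleftrightarrow> square_mat A \<and> (det A = 1 \<or> det A = -1)"

text \<open>Elements of the limit of \<open>\<int>\<^sup>n \<rightarrow> \<int>\<^sup>n \<rightarrow> \<int>\<^sup>n \<rightarrow> \<dots>\<close>, all maps being \<open>v \<mapsto> A v\<close>, are classes of
  pairs \<open>(k, v)\<close>, standing for \<open>v\<close> in the \<open>k\<close>-th copy of \<open>\<int>\<^sup>n\<close>; two pairs are identified when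
  their images agree at some later stage \<open>m\<close>.\<close>

definition dim_rel :: "int mat \<Rightarrow> ((nat \<times> int vec) \<times> (nat \<times> int vec)) set" where
  "dim_rel A = {((k, v), (l, w)). v \<in> carrier_vec (dim_row A) \<and> w \<in> carrier_vec (dim_row A) \<and>
     (\<exists>m. k \<le> m \<and> l \<le> m \<and> (A ^\<^sub>m (m - k)) *\<^sub>v v = (A ^\<^sub>m (m - l)) *\<^sub>v w)}"

definition dim_class :: "int mat \<Rightarrow> nat \<Rightarrow> int vec \<Rightarrow> (nat \<times> int vec) set" where
  "dim_class A k v = dim_rel A `` {(k, v)}"

text \<open>Pairs \<open>(k, v)\<close> and \<open>(l, w)\<close> are added by moving both to stage \<open>k + l\<close>. The unions over
  representatives are well defined, see \<open>dim_group_mult\<close> and \<open>dim_shift_class\<close> below.\<close>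

definition dim_group :: "int mat \<Rightarrow> (nat \<times> int vec) set monoid" where
  "dim_group A = \<lparr>
     carrier = (UNIV \<times> carrier_vec (dim_row A)) // dim_rel A,
     mult = (\<lambda>X Y. \<Union>(k, v)\<in>X. \<Union>(l, w)\<in>Y.
               dim_class A (k + l) ((A ^\<^sub>m l) *\<^sub>v v + (A ^\<^sub>m k) *\<^sub>v w)),
     one = dim_class A 0 (0\<^sub>v (dim_row A)) \<rparr>"

definition dim_pos :: "int mat \<Rightarrow> (nat \<times> int vec) set set" where
  "dim_pos A = {dim_class A k v | k v. v \<in> carrier_vec (dim_row A) \<and> 0\<^sub>v (dim_row A) \<le> v}"

definition dim_shift :: "int mat \<Rightarrow> (nat \<times> int vec) set \<Rightarrow> (nat \<times> int vec) set" where
  "dim_shift A X = (\<Union>(k, v)\<in>X. dim_class A k (A *\<^sub>v v))"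

context
  fixes A :: "int mat" and n :: nat
  assumes A: "A \<in> carrier_mat n n"
begin

lemma pow_vec_carrier: "v \<in> carrier_vec n \<Longrightarrow> (A ^\<^sub>m k) *\<^sub>v v \<in> carrier_vec n"
  by (rule mult_mat_vec_carrier[OF pow_carrier_mat[OF A]])

lemma pow_vec_add:
  assumes "v \<in> carrier_vec n"
  shows "(A ^\<^sub>m (k + l)) *\<^sub>v v = (A ^\<^sub>m k) *\<^sub>v ((A ^\<^sub>m l) *\<^sub>v v)"
proof -
  have "A ^\<^sub>m (k + l) = A ^\<^sub>m k * A ^\<^sub>m l"
  proof (induction l)
    case 0
    then show ?case using right_mult_one_mat[OF pow_carrier_mat[OF A, of k]] A by simp
  next
    case (Suc l)
    then show ?case
      using assoc_mult_mat[OF pow_carrier_mat[OF A, of k] pow_carrier_mat[OF A, of l] A] by simp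
  qed
  then show ?thesis
    using assoc_mult_mat_vec[OF pow_carrier_mat[OF A, of k] pow_carrier_mat[OF A, of l] assms] by simp
qed

lemma dim_rel_iff:
  "((k, v), (l, w)) \<in> dim_rel A \<longleftrightarrow> v \<in> carrier_vec n \<and> w \<in> carrier_vec n \<and>
     (\<exists>j. (A ^\<^sub>m (l + j)) *\<^sub>v v = (A ^\<^sub>m (k + j)) *\<^sub>v w)"
  (is "?L \<longleftrightarrow> ?R")
proof
  assume ?L
  then obtain m where vw: "v \<in> carrier_vec n" "w \<in> carrier_vec n" and m: "k \<le> m" "l \<le> m"
    and e: "(A ^\<^sub>m (m - k)) *\<^sub>v v = (A ^\<^sub>m (m - l)) *\<^sub>v w"
    using A by (auto simp: dim_rel_def)
  have "(A ^\<^sub>m ((k + l) + (m - k))) *\<^sub>v v = (A ^\<^sub>m ((k + l) + (m - l))) *\<^sub>v w"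
    unfolding pow_vec_add[OF vw(1)] pow_vec_add[OF vw(2)] e ..
  moreover have "(k + l) + (m - k) = l + m" "(k + l) + (m - l) = k + m" using m by auto
  ultimately show ?R using vw by auto
next
  assume ?R
  then obtain j where vw: "v \<in> carrier_vec n" "w \<in> carrier_vec n"
    and e: "(A ^\<^sub>m (l + j)) *\<^sub>v v = (A ^\<^sub>m (k + j)) *\<^sub>v w" by auto
  have "(A ^\<^sub>m ((k + l + j) - k)) *\<^sub>v v = (A ^\<^sub>m ((k + l + j) - l)) *\<^sub>v w"
    using e by (simp add: add.assoc)
  then show ?L using vw A by (auto simp: dim_rel_def intro!: exI[of _ "k + l + j"])
qed

lemma equiv_dim_rel: "equiv (UNIV \<times> carrier_vec n) (dim_rel A)"
proof (rule equivI)
  show "dim_rel A \<subseteq> (UNIV \<times> carrier_vec n) \<times> (UNIV \<times> carrier_vec n)"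
    using A by (auto simp: dim_rel_def)
  show "refl_on (UNIV \<times> carrier_vec n) (dim_rel A)"
    by (rule refl_onI) (auto simp: dim_rel_iff)
  show "sym (dim_rel A)"
    by (rule symI) (auto simp: dim_rel_iff, metis)
  show "trans (dim_rel A)"
  proof (rule transI, clarify)
    fix k v l w m u
    assume "((k, v), (l, w)) \<in> dim_rel A" "((l, w), (m, u)) \<in> dim_rel A"
    then obtain i j where c: "v \<in> carrier_vec n" "w \<in> carrier_vec n" "u \<in> carrier_vec n"
      and e: "(A ^\<^sub>m (l + i)) *\<^sub>v v = (A ^\<^sub>m (k + i)) *\<^sub>v w"
        "(A ^\<^sub>m (m + j)) *\<^sub>v w = (A ^\<^sub>m (l + j)) *\<^sub>v u"
      by (auto simp: dim_rel_iff)
    have "(A ^\<^sub>m ((m + j) + (l + i))) *\<^sub>v v = (A ^\<^sub>m ((k + i) + (m + j))) *\<^sub>v w"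
      using e(1) pow_vec_add[OF c(1), of "m + j" "l + i"] pow_vec_add[OF c(2), of "m + j" "k + i"]
      by (simp add: ac_simps)
    also have "\<dots> = (A ^\<^sub>m ((k + i) + (l + j))) *\<^sub>v u"
      using e(2) pow_vec_add[OF c(2), of "k + i" "m + j"] pow_vec_add[OF c(3), of "k + i" "l + j"]
      by simp
    finally have "(A ^\<^sub>m (m + (l + i + j))) *\<^sub>v v = (A ^\<^sub>m (k + (l + i + j))) *\<^sub>v u"
      by (simp add: ac_simps)
    then show "((k, v), (m, u)) \<in> dim_rel A" using c by (auto simp: dim_rel_iff)
  qed
qed

lemma dim_class_eq_iff:
  assumes "v \<in> carrier_vec n" "w \<in> carrier_vec n"
  shows "dim_class A k v = dim_class A l w \<longleftrightarrow> (\<exists>j. (A ^\<^sub>m (l + j)) *\<^sub>v v = (A ^\<^sub>m (k + j)) *\<^sub>v w)"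
  unfolding dim_class_def using eq_equiv_class_iff[OF equiv_dim_rel, of "(k, v)" "(l, w)"] assms
  by (simp add: dim_rel_iff)

lemma dim_class_shift:
  assumes "v \<in> carrier_vec n"
  shows "dim_class A (k + l) ((A ^\<^sub>m l) *\<^sub>v v) = dim_class A k v"
  using assms by (subst dim_class_eq_iff)
    (auto simp: pow_vec_carrier pow_vec_add[symmetric] ac_simps intro!: exI[of _ 0])

lemma carrier_dim_group: "carrier (dim_group A) = {dim_class A k v | k v. v \<in> carrier_vec n}"
  using A by (auto simp: dim_group_def dim_class_def quotient_def)

lemma dim_group_mult:
  assumes v: "v \<in> carrier_vec n" and w: "w \<in> carrier_vec n"
  shows "dim_class A k v \<otimes>\<^bsub>dim_group A\<^esub> dim_class A l w =
    dim_class A (k + l) ((A ^\<^sub>m l) *\<^sub>v v + (A ^\<^sub>m k) *\<^sub>v w)"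
proof -
  let ?f = "\<lambda>(k, v) (l, w). dim_class A (k + l) ((A ^\<^sub>m l) *\<^sub>v v + (A ^\<^sub>m k) *\<^sub>v w)"
  have 1: "?f (k, v) (l, w) = ?f (k', v') (l, w)"
    if w: "w \<in> carrier_vec n" and r: "((k, v), (k', v')) \<in> dim_rel A" for k v k' v' l w
  proof -
    from r obtain j where c: "v \<in> carrier_vec n" "v' \<in> carrier_vec n"
      and e: "(A ^\<^sub>m (k' + j)) *\<^sub>v v = (A ^\<^sub>m (k + j)) *\<^sub>v v'" by (auto simp: dim_rel_iff)
    have "(A ^\<^sub>m (k' + l + j)) *\<^sub>v ((A ^\<^sub>m l) *\<^sub>v v) = (A ^\<^sub>m (l + l)) *\<^sub>v ((A ^\<^sub>m (k' + j)) *\<^sub>v v)"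
      using c by (simp add: pow_vec_add[symmetric] ac_simps)
    also have "\<dots> = (A ^\<^sub>m (k + l + j)) *\<^sub>v ((A ^\<^sub>m l) *\<^sub>v v')"
      unfolding e using c by (simp add: pow_vec_add[symmetric] ac_simps)
    finally have a: "(A ^\<^sub>m (k' + l + j)) *\<^sub>v ((A ^\<^sub>m l) *\<^sub>v v) =
      (A ^\<^sub>m (k + l + j)) *\<^sub>v ((A ^\<^sub>m l) *\<^sub>v v')" .
    have b: "(A ^\<^sub>m (k' + l + j)) *\<^sub>v ((A ^\<^sub>m k) *\<^sub>v w) = (A ^\<^sub>m (k + l + j)) *\<^sub>v ((A ^\<^sub>m k') *\<^sub>v w)"
      using w by (simp add: pow_vec_add[symmetric] ac_simps)
    note d = mult_add_distrib_mat_vec[OF pow_carrier_mat[OF A] pow_vec_carrier pow_vec_carrier]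
    show ?thesis
      using c w a b
      by (simp, subst dim_class_eq_iff) (auto simp: d pow_vec_carrier intro!: exI[of _ j])
  qed
  have comm: "?f x y = ?f y x" if "x \<in> UNIV \<times> carrier_vec n" "y \<in> UNIV \<times> carrier_vec n" for x y
    using that by (auto simp: add.commute comm_add_vec[OF pow_vec_carrier pow_vec_carrier])
  have "congruent2 (dim_rel A) (dim_rel A) ?f"
  proof (rule congruent2_commuteI[OF equiv_dim_rel])
    show "?f y z = ?f z y" if "y \<in> UNIV \<times> carrier_vec n" "z \<in> UNIV \<times> carrier_vec n" for y z
      using comm[OF that] .
    show "?f x y = ?f x z" if "x \<in> UNIV \<times> carrier_vec n" "(y, z) \<in> dim_rel A" for x y z
    proof -
      have yz: "y \<in> UNIV \<times> carrier_vec n" "z \<in> UNIV \<times> carrier_vec n"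
        using that(2) by (cases y; cases z; auto simp: dim_rel_iff)+
      have "?f y x = ?f z x" using that 1 by (cases x; cases y; cases z) auto
      then show ?thesis using comm[OF that(1) yz(1)] comm[OF that(1) yz(2)] by simp
    qed
  qed
  from UN_equiv_class2[OF equiv_dim_rel equiv_dim_rel this, of "(k, v)" "(l, w)"] v w
  show ?thesis by (simp add: dim_group_def dim_class_def case_prod_unfold)
qed

lemma dim_shift_class:
  assumes v: "v \<in> carrier_vec n"
  shows "dim_shift A (dim_class A k v) = dim_class A k (A *\<^sub>v v)"
proof -
  have A1: "A *\<^sub>v u = (A ^\<^sub>m 1) *\<^sub>v u" for u using A by simp
  have "congruent (dim_rel A) (\<lambda>(k, v). dim_class A k (A *\<^sub>v v))"
  proof (rule congruentI, clarify)
    fix k v l w assume "((k, v), (l, w)) \<in> dim_rel A"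
    then obtain j where c: "v \<in> carrier_vec n" "w \<in> carrier_vec n"
      and e: "(A ^\<^sub>m (l + j)) *\<^sub>v v = (A ^\<^sub>m (k + j)) *\<^sub>v w" by (auto simp: dim_rel_iff)
    have "(A ^\<^sub>m (l + j)) *\<^sub>v (A *\<^sub>v v) = (A ^\<^sub>m 1) *\<^sub>v ((A ^\<^sub>m (l + j)) *\<^sub>v v)"
      unfolding A1[of v] pow_vec_add[OF c(1), symmetric] by (simp only: add.commute)
    also have "\<dots> = (A ^\<^sub>m (k + j)) *\<^sub>v (A *\<^sub>v w)"
      unfolding e A1[of w] pow_vec_add[OF c(2), symmetric] by (simp only: add.commute)
    finally have "(A ^\<^sub>m (l + j)) *\<^sub>v (A *\<^sub>v v) = (A ^\<^sub>m (k + j)) *\<^sub>v (A *\<^sub>v w)" .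
    then show "dim_class A k (A *\<^sub>v v) = dim_class A l (A *\<^sub>v w)"
      using c mult_mat_vec_carrier[OF A c(1)] mult_mat_vec_carrier[OF A c(2)]
      by (subst dim_class_eq_iff) auto
  qed
  from UN_equiv_class[OF equiv_dim_rel this, of "(k, v)"] v
  show ?thesis by (simp add: dim_shift_def dim_class_def)
qed

lemma comm_group_dim_group: "comm_group (dim_group A)"
proof (rule comm_groupI)
  have one: "\<one>\<^bsub>dim_group A\<^esub> = dim_class A 0 (0\<^sub>v n)"
    using A by (simp add: dim_group_def)
  note cl = pow_vec_carrier mult_add_distrib_mat_vec[OF pow_carrier_mat[OF A] pow_vec_carrier pow_vec_carrier]
  show "x \<otimes>\<^bsub>dim_group A\<^esub> y \<in> carrier (dim_group A)"
    if "x \<in> carrier (dim_group A)" "y \<in> carrier (dim_group A)" for x y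
  proof -
    from that obtain k v l w where xy: "x = dim_class A k v" "y = dim_class A l w"
      and c: "v \<in> carrier_vec n" "w \<in> carrier_vec n"
      unfolding carrier_dim_group by blast
    have "(A ^\<^sub>m l) *\<^sub>v v + (A ^\<^sub>m k) *\<^sub>v w \<in> carrier_vec n" using c by (simp add: cl)
    then show ?thesis unfolding xy dim_group_mult[OF c] carrier_dim_group by blast
  qed
  show "\<one>\<^bsub>dim_group A\<^esub> \<in> carrier (dim_group A)"
    unfolding one carrier_dim_group using zero_carrier_vec[of n] by blast
  show "x \<otimes>\<^bsub>dim_group A\<^esub> y \<otimes>\<^bsub>dim_group A\<^esub> z = x \<otimes>\<^bsub>dim_group A\<^esub> (y \<otimes>\<^bsub>dim_group A\<^esub> z)"
    if xyz: "x \<in> carrier (dim_group A)" "y \<in> carrier (dim_group A)" "z \<in> carrier (dim_group A)"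
    for x y z
  proof -
    from xyz obtain i u j v k w where "x = dim_class A i u" "y = dim_class A j v" "z = dim_class A k w"
      and c: "u \<in> carrier_vec n" "v \<in> carrier_vec n" "w \<in> carrier_vec n"
      unfolding carrier_dim_group by blast
    then show ?thesis
      using assoc_add_vec[OF pow_vec_carrier[OF c(1), of "j + k"] pow_vec_carrier[OF c(2), of "i + k"]
          pow_vec_carrier[OF c(3), of "i + j"]]
      by (simp add: dim_group_mult cl pow_vec_add[symmetric] add.commute add.left_commute add.assoc)
  qed
  show "x \<otimes>\<^bsub>dim_group A\<^esub> y = y \<otimes>\<^bsub>dim_group A\<^esub> x"
    if "x \<in> carrier (dim_group A)" "y \<in> carrier (dim_group A)" for x y
    using that by (auto simp: carrier_dim_group dim_group_mult add.commute
        comm_add_vec[OF pow_vec_carrier pow_vec_carrier])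
  show "\<one>\<^bsub>dim_group A\<^esub> \<otimes>\<^bsub>dim_group A\<^esub> x = x" if "x \<in> carrier (dim_group A)" for x
  proof -
    have z: "(A ^\<^sub>m k) *\<^sub>v 0\<^sub>v n = 0\<^sub>v n" for k using A by (intro eq_vecI) auto
    from that obtain k v where "x = dim_class A k v" "v \<in> carrier_vec n"
      unfolding carrier_dim_group by blast
    then show ?thesis using A by (simp add: one dim_group_mult z)
  qed
  show "\<exists>y\<in>carrier (dim_group A). y \<otimes>\<^bsub>dim_group A\<^esub> x = \<one>\<^bsub>dim_group A\<^esub>"
    if "x \<in> carrier (dim_group A)" for x
  proof -
    from that obtain k v where x: "x = dim_class A k v" and v: "v \<in> carrier_vec n"
      unfolding carrier_dim_group by blast
    have m: "(A ^\<^sub>m k) *\<^sub>v (- v) = - ((A ^\<^sub>m k) *\<^sub>v v)"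
      using A v by (intro eq_vecI) auto
    have z: "(A ^\<^sub>m j) *\<^sub>v 0\<^sub>v n = 0\<^sub>v n" for j using A by (intro eq_vecI) auto
    have "dim_class A k (- v) \<otimes>\<^bsub>dim_group A\<^esub> x = \<one>\<^bsub>dim_group A\<^esub>"
      unfolding x one using v pow_vec_carrier[OF v, of k]
      by (simp add: dim_group_mult m dim_class_eq_iff z)
    then show ?thesis using v unfolding carrier_dim_group using uminus_carrier_vec[of v n] by blast
  qed
qed

end

definition dim_order_iso :: "int mat \<Rightarrow> int mat \<Rightarrow> ((nat \<times> int vec) set \<Rightarrow> (nat \<times> int vec) set) set" where
  "dim_order_iso A B = {\<theta> \<in> iso (dim_group A) (dim_group B). \<theta> ` dim_pos A = dim_pos B}"

text \<open>Strong stable isomorphism of the stationary AF-algebras given by \<open>A\<close> and \<open>A'\<close>, expressed on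
  their dimension groups. Order units play no role.\<close>

definition strongly_stably_isomorphic :: "int mat \<Rightarrow> int mat \<Rightarrow> bool" where
  "strongly_stably_isomorphic A A' \<longleftrightarrow>
     (\<exists>\<theta> \<in> dim_order_iso A' A. \<forall>x \<in> carrier (dim_group A'). dim_shift A (\<theta> x) = \<theta> (dim_shift A' x))"

definition poly_mat :: "'a::comm_ring_1 poly \<Rightarrow> 'a mat \<Rightarrow> 'a mat" where
  "poly_mat p A = mat (dim_row A) (dim_row A) (\<lambda>(i, j). \<Sum>k\<le>degree p. coeff p k * (A ^\<^sub>m k) $$ (i, j))"

definition Ab :: "int poly \<Rightarrow> int mat \<Rightarrow> int vec set monoid" where
  "Ab p A = monoid_vec TYPE(int) (dim_row A) Mod ((\<lambda>v. poly_mat p A *\<^sub>v v) ` carrier_vec (dim_row A))"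

end

theory Submission
  imports Defs
begin

text \<open>For unimodular \<open>A\<close> all maps of the direct system are bijective, so \<open>v \<mapsto> [0, v]\<close> identifies the
  dimension group with \<open>\<int>\<^sup>n\<close> and the shift automorphism with \<open>A\<close>. A strong stable isomorphism thus
  becomes a group isomorphism \<open>\<phi>\<close> with \<open>\<phi> A' = A \<phi>\<close>; it satisfies \<open>\<phi> p(A') = p(A) \<phi>\<close> and so maps
  \<open>p(A') \<int>\<^sup>n\<^sup>'\<close> onto \<open>p(A) \<int>\<^sup>n\<close>.\<close>

section \<open>Quotients by subgroups that correspond under an isomorphism\<close>

lemma FactGroup_iso_image:
  assumes G: "group G" and \<phi>: "\<phi> \<in> iso G H" and M: "M \<subseteq> carrier G" and N: "\<phi> ` M \<lhd> H"
  shows "G Mod M \<cong> H Mod (\<phi> ` M)"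
proof -
  let ?q = "\<lambda>x. \<phi> ` M #>\<^bsub>H\<^esub> x"
  have hom: "\<phi> \<in> hom G H" and inj: "inj_on \<phi> (carrier G)" and surj: "\<phi> ` carrier G = carrier H"
    using \<phi> by (auto simp: iso_def bij_betw_def)
  have H: "group H" and sub: "subgroup (\<phi> ` M) H"
    using N by (auto simp: normal_def normal_imp_subgroup)
  have "?q \<circ> \<phi> \<in> hom G (H Mod (\<phi> ` M))"
    by (rule hom_compose[OF hom normal.r_coset_hom_Mod[OF N]])
  then interpret q: group_hom G "H Mod (\<phi> ` M)" "?q \<circ> \<phi>"
    using G normal.factorgroup_is_group[OF N] by (simp add: group_hom_def group_hom_axioms_def)
  have "?q (\<phi> x) = \<phi> ` M \<longleftrightarrow> x \<in> M" if x: "x \<in> carrier G" for x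
  proof -
    have c: "\<phi> x \<in> carrier H" using x surj by blast
    have "?q (\<phi> x) = \<phi> ` M \<longleftrightarrow> \<phi> x \<in> \<phi> ` M"
      using group.coset_join1[OF H _ c sub] group.coset_join2[OF H c sub] by blast
    then show ?thesis using inj_on_image_mem_iff[OF inj x M] by simp
  qed
  then have "kernel G (H Mod (\<phi> ` M)) (?q \<circ> \<phi>) = M"
    using M by (auto simp: kernel_def)
  moreover have "(?q \<circ> \<phi>) ` carrier G = carrier (H Mod (\<phi> ` M))"
    unfolding carrier_FactGroup surj[symmetric] by (simp add: image_comp)
  ultimately show ?thesis using q.FactGroup_iso by simp
qed

section \<open>Polynomials in a matrix and the additive maps that intertwine them\<close>

lemma poly_mat_carrier: "A \<in> carrier_mat n n \<Longrightarrow> poly_mat p A \<in> carrier_mat n n"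
  by (simp add: poly_mat_def)

lemma poly_mat_0: "A \<in> carrier_mat n n \<Longrightarrow> poly_mat 0 A = 0\<^sub>m n n"
  by (intro eq_matI) (auto simp: poly_mat_def)

text \<open>Horner's recursion. It replaces the explicit sum over powers in \<open>poly_mat\<close>
  by a form that fits induction on \<open>p\<close>.\<close>

lemma poly_mat_pCons:
  assumes A: "A \<in> carrier_mat n n"
  shows "poly_mat (pCons a p) A = a \<cdot>\<^sub>m 1\<^sub>m n + poly_mat p A * A"
proof (rule eq_matI)
  fix i j assume "i < dim_row (a \<cdot>\<^sub>m 1\<^sub>m n + poly_mat p A * A)" "j < dim_col (a \<cdot>\<^sub>m 1\<^sub>m n + poly_mat p A * A)"
  then have i: "i < n" and j: "j < n" using A poly_mat_carrier[OF A, of p] by auto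
  have Suc: "(A ^\<^sub>m Suc k) $$ (i, j) = (\<Sum>l<n. (A ^\<^sub>m k) $$ (i, l) * A $$ (l, j))" for k
    using i j A pow_carrier_mat[OF A, of k] by (auto simp: scalar_prod_def atLeast0LessThan)
  have "poly_mat (pCons a p) A $$ (i, j)
      = (\<Sum>k\<le>degree (pCons a p). coeff (pCons a p) k * (A ^\<^sub>m k) $$ (i, j))"
    using i j A by (simp add: poly_mat_def)
  \<comment> \<open>For \<open>p = 0\<close> the degree of \<open>pCons a p\<close> is 0, not
    \<open>Suc (degree p)\<close>; padding with zero coefficients treats both cases alike.\<close>
  also have "\<dots> = (\<Sum>k\<le>Suc (degree p). coeff (pCons a p) k * (A ^\<^sub>m k) $$ (i, j))"
    by (rule sum.mono_neutral_left)
      (use degree_pCons_le[of a p] in \<open>auto simp: coeff_eq_0\<close>)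
  also have "\<dots> = a * 1\<^sub>m n $$ (i, j) + (\<Sum>k\<le>degree p. coeff p k * (A ^\<^sub>m Suc k) $$ (i, j))"
    using A by (subst sum.atMost_Suc_shift) simp
  also have "(\<Sum>k\<le>degree p. coeff p k * (A ^\<^sub>m Suc k) $$ (i, j))
      = (\<Sum>k\<le>degree p. \<Sum>l<n. coeff p k * (A ^\<^sub>m k) $$ (i, l) * A $$ (l, j))"
    unfolding Suc by (simp add: sum_distrib_left mult.assoc)
  also have "\<dots> = (\<Sum>l<n. \<Sum>k\<le>degree p. coeff p k * (A ^\<^sub>m k) $$ (i, l) * A $$ (l, j))"
    by (rule sum.swap)
  also have "\<dots> = (poly_mat p A * A) $$ (i, j)"
    using i j A by (simp add: poly_mat_def scalar_prod_def atLeast0LessThan sum_distrib_right)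
  finally show "poly_mat (pCons a p) A $$ (i, j) = (a \<cdot>\<^sub>m 1\<^sub>m n + poly_mat p A * A) $$ (i, j)"
    using i j A poly_mat_carrier[OF A, of p] by simp
qed (use A in \<open>auto simp: poly_mat_def\<close>)

lemma poly_mat_pCons_mult_vec:
  assumes A: "A \<in> carrier_mat n n" and v: "v \<in> carrier_vec n"
  shows "poly_mat (pCons a p) A *\<^sub>v v = a \<cdot>\<^sub>v v + poly_mat p A *\<^sub>v (A *\<^sub>v v)"
proof -
  have "(a \<cdot>\<^sub>m 1\<^sub>m n) *\<^sub>v v = a \<cdot>\<^sub>v v"
    using v by (intro eq_vecI) (auto simp: smult_scalar_prod_distrib[where n = n])
  then show ?thesis
    using v A poly_mat_carrier[OF A, of p]
    by (simp add: poly_mat_pCons add_mult_distrib_mat_vec[where nr = n and nc = n]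
        assoc_mult_mat_vec[where n\<^sub>1 = n and n\<^sub>2 = n and n\<^sub>3 = n])
qed

text \<open>An integer multiple is a repeated sum or difference, so an additive map is automatically
  linear over the integers. The induction runs upwards and downwards from 0; the start and the
  downward step add \<phi> \<open>v\<close> to both sides and cancel it.\<close>

lemma monoid_vec_hom_smult:
  fixes \<phi> :: "int vec \<Rightarrow> int vec"
  assumes \<phi>: "\<phi> \<in> hom (monoid_vec TYPE(int) n) (monoid_vec TYPE(int) m)" and v: "v \<in> carrier_vec n"
  shows "\<phi> (a \<cdot>\<^sub>v v) = a \<cdot>\<^sub>v \<phi> v"
proof -
  have add: "\<phi> (u + w) = \<phi> u + \<phi> w" if "u \<in> carrier_vec n" "w \<in> carrier_vec n" for u w
    using hom_mult[OF \<phi>] that by (simp add: monoid_vec_simps)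
  have c: "\<phi> u \<in> carrier_vec m" if "u \<in> carrier_vec n" for u
    using hom_in_carrier[OF \<phi>] that by (simp add: monoid_vec_simps)
  have cancel: "x = y" if "x + w = y + w" "x \<in> carrier_vec m" "y \<in> carrier_vec m" "w \<in> carrier_vec m"
    for x y w :: "int vec"
    using group.right_cancel[OF comm_group.axioms(2)[OF comm_group_vec], of w m x y] that
    by (simp add: monoid_vec_simps)
  have step: "(b + 1) \<cdot>\<^sub>v u = b \<cdot>\<^sub>v u + u" for b :: int and u
    by (intro eq_vecI) (auto simp: algebra_simps)
  have step': "\<phi> ((b + 1) \<cdot>\<^sub>v v) = \<phi> (b \<cdot>\<^sub>v v) + \<phi> v" for b
    using v by (simp add: step add)
  have z: "\<phi> (0 \<cdot>\<^sub>v v) = 0 \<cdot>\<^sub>v \<phi> v"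
  proof (rule cancel)
    show "\<phi> (0 \<cdot>\<^sub>v v) + \<phi> v = 0 \<cdot>\<^sub>v \<phi> v + \<phi> v"
      unfolding step'[symmetric] step[symmetric] by simp
  qed (use c v in auto)
  show ?thesis
  proof (induction a rule: int_induct[where k = 0])
    case base
    show ?case by (rule z)
  next
    case (step1 b)
    then show ?case by (simp only: step' step[of b "\<phi> v"])
  next
    case (step2 b)
    have "\<phi> ((b - 1) \<cdot>\<^sub>v v) + \<phi> v = b \<cdot>\<^sub>v \<phi> v"
      using step'[of "b - 1"] step2 by simp
    also have "b \<cdot>\<^sub>v \<phi> v = (b - 1) \<cdot>\<^sub>v \<phi> v + \<phi> v"
      using step[of "b - 1" "\<phi> v"] by simp
    finally show ?case
      by (rule cancel) (use c v in auto)
  qed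
qed

text \<open>Horner induction on \<open>p\<close>. The vector has to be arbitrary, since the
  recursion calls the hypothesis at \<open>B *\<^sub>v v\<close>, where \<open>comm\<close> then
  moves \<phi> past \<open>B\<close>.\<close>

lemma poly_mat_intertwine:
  fixes A B :: "int mat" and \<phi> :: "int vec \<Rightarrow> int vec"
  assumes A: "A \<in> carrier_mat n n" and B: "B \<in> carrier_mat m m"
    and \<phi>: "\<phi> \<in> hom (monoid_vec TYPE(int) m) (monoid_vec TYPE(int) n)"
    and comm: "\<And>v. v \<in> carrier_vec m \<Longrightarrow> \<phi> (B *\<^sub>v v) = A *\<^sub>v \<phi> v"
    and v: "v \<in> carrier_vec m"
  shows "\<phi> (poly_mat p B *\<^sub>v v) = poly_mat p A *\<^sub>v \<phi> v"
  using v
proof (induction p arbitrary: v)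
  case 0
  have "\<phi> v \<in> carrier_vec n"
    using hom_in_carrier[OF \<phi>] 0 by (simp add: monoid_vec_simps)
  moreover have "\<phi> (0\<^sub>v m) = 0\<^sub>v n"
    using hom_one[OF \<phi> comm_group.axioms(2)[OF comm_group_vec] comm_group.axioms(2)[OF comm_group_vec]]
    by (simp add: monoid_vec_simps)
  moreover have "0\<^sub>m k k *\<^sub>v u = 0\<^sub>v k" if "u \<in> carrier_vec k" for k and u :: "int vec"
    using that by (intro eq_vecI) auto
  ultimately show ?case using 0 by (simp add: poly_mat_0[OF A] poly_mat_0[OF B])
next
  case (pCons a p)
  have \<phi>v: "\<phi> v \<in> carrier_vec n"
    using hom_in_carrier[OF \<phi>] pCons.prems by (simp add: monoid_vec_simps)
  have Bv: "B *\<^sub>v v \<in> carrier_vec m"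
    by (rule mult_mat_vec_carrier[OF B pCons.prems])
  have "\<phi> (a \<cdot>\<^sub>v v + poly_mat p B *\<^sub>v (B *\<^sub>v v)) = \<phi> (a \<cdot>\<^sub>v v) + \<phi> (poly_mat p B *\<^sub>v (B *\<^sub>v v))"
    using hom_mult[OF \<phi>] pCons.prems mult_mat_vec_carrier[OF poly_mat_carrier[OF B] Bv]
    by (simp add: monoid_vec_simps)
  then show ?case
    using pCons.IH[OF Bv] pCons.prems \<phi>v
    by (simp add: poly_mat_pCons_mult_vec[OF A] poly_mat_pCons_mult_vec[OF B]
        monoid_vec_hom_smult[OF \<phi>] comm)
qed

text \<open>Applied to \<open>poly_mat p A\<close>, this makes the set divided out in
  \<open>Ab\<close> a subgroup, and a normal one because the ambient group is commutative.\<close>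

lemma subgroup_mult_mat_vec_range:
  fixes P :: "int mat"
  assumes P: "P \<in> carrier_mat n m"
  shows "subgroup ((*\<^sub>v) P ` carrier_vec m) (monoid_vec TYPE(int) n)"
proof -
  interpret group_hom "monoid_vec TYPE(int) m" "monoid_vec TYPE(int) n" "(*\<^sub>v) P"
    using comm_group.axioms(2)[OF comm_group_vec] P
    by (auto simp: group_hom_def group_hom_axioms_def hom_def monoid_vec_simps
        mult_add_distrib_mat_vec[OF P])
  show ?thesis
    using img_is_subgroup by (simp add: monoid_vec_simps)
qed

section \<open>Unimodular matrices, and the dimension group as Z^n\<close>

text \<open>The product of \<open>A\<close> and its adjugate is \<open>det A\<close> times the
  identity. As \<open>det A\<close> is 1 or -1, it is its own inverse, so scaling the adjugate by it
  gives an inverse with integer entries.\<close>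

lemma unimodular_left_right_inverse:
  fixes A :: "int mat"
  assumes A: "A \<in> carrier_mat n n" and u: "unimodular A"
  obtains B where "B \<in> carrier_mat n n" "A * B = 1\<^sub>m n" "B * A = 1\<^sub>m n"
proof
  have d: "det A * det A = 1" using u by (auto simp: unimodular_def)
  note adj = adj_mat[OF A]
  show "det A \<cdot>\<^sub>m adj_mat A \<in> carrier_mat n n" using adj by simp
  show "A * (det A \<cdot>\<^sub>m adj_mat A) = 1\<^sub>m n"
    by (subst mult_smult_distrib[OF A adj(1)]) (auto simp: adj d)
  show "det A \<cdot>\<^sub>m adj_mat A * A = 1\<^sub>m n"
    by (subst mult_smult_assoc_mat[OF adj(1) A]) (auto simp: adj d)
qed

text \<open>Powers occur here because two vectors of the same stage have the same class as soon as
  some power of \<open>A\<close> makes them equal.\<close>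

lemma inj_pow_mult_vec:
  fixes A :: "int mat"
  assumes A: "A \<in> carrier_mat n n" and u: "unimodular A"
    and v: "v \<in> carrier_vec n" and w: "w \<in> carrier_vec n"
    and eq: "A ^\<^sub>m k *\<^sub>v v = A ^\<^sub>m k *\<^sub>v w"
  shows "v = w"
  using v w eq
proof (induction k arbitrary: v w)
  case 0
  then show ?case using A by simp
next
  case (Suc k)
  obtain B where B: "B \<in> carrier_mat n n" "B * A = 1\<^sub>m n"
    by (rule unimodular_left_right_inverse[OF A u])
  have "A *\<^sub>v v = A *\<^sub>v w"
    using Suc.IH[OF mult_mat_vec_carrier[OF A Suc.prems(1)] mult_mat_vec_carrier[OF A Suc.prems(2)]]
      Suc.prems A by (simp add: assoc_mult_mat_vec[OF pow_carrier_mat[OF A] A])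
  then have "B *\<^sub>v (A *\<^sub>v v) = B *\<^sub>v (A *\<^sub>v w)" by simp
  then show ?case
    using Suc.prems B by (simp add: assoc_mult_mat_vec[OF B(1) A, symmetric])
qed

text \<open>This allows a vector at stage \<open>k\<close> to be pulled back to stage 0.\<close>

lemma surj_pow_mult_vec:
  fixes A :: "int mat"
  assumes A: "A \<in> carrier_mat n n" and u: "unimodular A" and v: "v \<in> carrier_vec n"
  shows "\<exists>w \<in> carrier_vec n. A ^\<^sub>m k *\<^sub>v w = v"
proof (induction k)
  case 0
  then show ?case using A v by (auto intro!: bexI[of _ v])
next
  case (Suc k)
  then obtain w where w: "w \<in> carrier_vec n" "A ^\<^sub>m k *\<^sub>v w = v" by blast
  obtain B where B: "B \<in> carrier_mat n n" "A * B = 1\<^sub>m n"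
    by (rule unimodular_left_right_inverse[OF A u])
  have Bw: "B *\<^sub>v w \<in> carrier_vec n" by (rule mult_mat_vec_carrier[OF B(1) w(1)])
  have "A *\<^sub>v (B *\<^sub>v w) = w"
    using w B by (simp add: assoc_mult_mat_vec[OF A B(1), symmetric])
  then have "A ^\<^sub>m Suc k *\<^sub>v (B *\<^sub>v w) = v"
    using w Bw by (simp add: assoc_mult_mat_vec[OF pow_carrier_mat[OF A] A])
  then show ?case using Bw by blast
qed

text \<open>Each class has exactly one representative at stage 0: solving
  \<open>A ^\<^sub>m k *\<^sub>v w = v\<close> yields one, and injectivity of the powers excludes a
  second. At stage 0 the sum of classes involves only \<open>A ^\<^sub>m 0\<close>, so it is plain
  vector addition.\<close>

lemma iso_dim_class:
  assumes A: "A \<in> carrier_mat n n" and u: "unimodular A"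
  shows "dim_class A 0 \<in> iso (monoid_vec TYPE(int) n) (dim_group A)"
proof -
  have "inj_on (dim_class A 0) (carrier_vec n)"
    using inj_pow_mult_vec[OF A u] by (auto simp: inj_on_def dim_class_eq_iff[OF A])
  moreover have "dim_class A k v \<in> dim_class A 0 ` carrier_vec n" if v: "v \<in> carrier_vec n" for k v
  proof -
    obtain w where w: "w \<in> carrier_vec n" "A ^\<^sub>m k *\<^sub>v w = v"
      using surj_pow_mult_vec[OF A u v] by blast
    then have "dim_class A k v = dim_class A 0 w"
      using dim_class_shift[OF A w(1), of 0 k] by simp
    then show ?thesis using w(1) by blast
  qed
  ultimately show ?thesis
    using A by (auto simp: iso_def bij_betw_def hom_def monoid_vec_simps carrier_dim_group[OF A]
        dim_group_mult[OF A])
qed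

theorem theorem1:
  fixes A A' :: "int mat" and n n' :: nat and p :: "int poly"
  assumes "n > 0" and "n' > 0"
    and "A \<in> carrier_mat n n" and "A' \<in> carrier_mat n' n'"
    and "unimodular A" and "unimodular A'"
    and "\<forall>i<n. \<forall>j<n. A $$ (i, j) \<ge> 0"
    and "\<forall>i<n'. \<forall>j<n'. A' $$ (i, j) \<ge> 0"
    and "\<exists>k>0. \<forall>i<n. \<forall>j<n. (A ^\<^sub>m k) $$ (i, j) > 0"
    and "\<exists>k>0. \<forall>i<n'. \<forall>j<n'. (A' ^\<^sub>m k) $$ (i, j) > 0"
    and "poly p 0 = 1 \<or> poly p 0 = -1"
    and "strongly_stably_isomorphic A A'"
  shows "Ab p A \<cong> Ab p A'"
proof -
  let ?Z = "monoid_vec TYPE(int)"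
  note A = assms(3) and B = assms(4) and uA = assms(5) and uB = assms(6)
  have Z: "group (?Z m)" for m by (rule comm_group.axioms(2)[OF comm_group_vec])
  have eA: "dim_class A 0 \<in> iso (?Z n) (dim_group A)" by (rule iso_dim_class[OF A uA])
  have eB: "dim_class A' 0 \<in> iso (?Z n') (dim_group A')" by (rule iso_dim_class[OF B uB])
  from assms(12) obtain \<theta> where \<theta>: "\<theta> \<in> iso (dim_group A') (dim_group A)"
    and shift: "\<And>x. x \<in> carrier (dim_group A') \<Longrightarrow> dim_shift A (\<theta> x) = \<theta> (dim_shift A' x)"
    by (auto simp: strongly_stably_isomorphic_def dim_order_iso_def)
  \<comment> \<open>\<phi> is \<theta> read in the stage 0 coordinates of both dimension
    groups.\<close>
  define \<phi> where "\<phi> = inv_into (carrier_vec n) (dim_class A 0) \<circ> (\<theta> \<circ> dim_class A' 0)"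
  have \<phi>: "\<phi> \<in> iso (?Z n') (?Z n)"
    using iso_set_trans[OF iso_set_trans[OF eB \<theta>] group.iso_set_sym[OF Z eA]]
    by (simp add: \<phi>_def monoid_vec_simps)
  have hom: "\<phi> \<in> hom (?Z n') (?Z n)" and surj: "\<phi> ` carrier_vec n' = carrier_vec n"
    using \<phi> by (auto simp: iso_def bij_betw_def monoid_vec_simps)
  have inj: "inj_on (dim_class A 0) (carrier_vec n)"
    and onto: "dim_class A 0 ` carrier_vec n = carrier (dim_group A)"
    using eA by (auto simp: iso_def bij_betw_def monoid_vec_simps)
  have cB: "dim_class A' 0 v \<in> carrier (dim_group A')" if "v \<in> carrier_vec n'" for v
    using that carrier_dim_group[OF B] by blast
  have \<theta>c: "\<theta> x \<in> carrier (dim_group A)" if "x \<in> carrier (dim_group A')" for x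
    using \<theta> that by (auto simp: iso_def hom_def)
  have \<phi>_class: "dim_class A 0 (\<phi> v) = \<theta> (dim_class A' 0 v)" if "v \<in> carrier_vec n'" for v
    using \<theta>c[OF cB[OF that]] by (simp add: \<phi>_def f_inv_into_f onto)
  \<comment> \<open>The equation is checked after applying the injective map
    \<open>dim_class A 0\<close>, which turns multiplication by the matrices into the shifts that
    \<theta> conjugates.\<close>
  have comm: "\<phi> (A' *\<^sub>v v) = A *\<^sub>v \<phi> v" if v: "v \<in> carrier_vec n'" for v
  proof (rule inj_onD[OF inj])
    have \<phi>v: "\<phi> v \<in> carrier_vec n" using surj v by blast
    have Bv: "A' *\<^sub>v v \<in> carrier_vec n'" by (rule mult_mat_vec_carrier[OF B v])
    show "\<phi> (A' *\<^sub>v v) \<in> carrier_vec n" using surj Bv by blast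
    show "A *\<^sub>v \<phi> v \<in> carrier_vec n" by (rule mult_mat_vec_carrier[OF A \<phi>v])
    have "dim_class A 0 (\<phi> (A' *\<^sub>v v)) = \<theta> (dim_shift A' (dim_class A' 0 v))"
      by (simp add: \<phi>_class[OF Bv] dim_shift_class[OF B v])
    also have "\<dots> = dim_shift A (dim_class A 0 (\<phi> v))"
      by (simp add: shift[OF cB[OF v]] \<phi>_class[OF v])
    also have "\<dots> = dim_class A 0 (A *\<^sub>v \<phi> v)"
      by (rule dim_shift_class[OF A \<phi>v])
    finally show "dim_class A 0 (\<phi> (A' *\<^sub>v v)) = dim_class A 0 (A *\<^sub>v \<phi> v)" .
  qed
  let ?M = "(*\<^sub>v) (poly_mat p A') ` carrier_vec n'" and ?N = "(*\<^sub>v) (poly_mat p A) ` carrier_vec n"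
  have "\<phi> ` ?M = (\<lambda>v. poly_mat p A *\<^sub>v \<phi> v) ` carrier_vec n'"
    using poly_mat_intertwine[OF A B hom comm] by (simp add: image_image)
  also have "\<dots> = ?N" unfolding surj[symmetric] image_image ..
  finally have MN: "\<phi> ` ?M = ?N" .
  have nA: "?N \<lhd> ?Z n" and nB: "?M \<lhd> ?Z n'"
    by (intro comm_group.subgroup_imp_normal[OF comm_group_vec]
        subgroup_mult_mat_vec_range poly_mat_carrier A B)+
  have "?M \<subseteq> carrier (?Z n')"
    using subgroup.subset[OF normal_imp_subgroup[OF nB]] .
  from FactGroup_iso_image[OF Z \<phi> this] have "?Z n' Mod ?M \<cong> ?Z n Mod ?N"
    using nA by (simp add: MN)
  \<comment> \<open>\<theta>, and with it \<phi>, runs from the side of \<open>A'\<close> to that of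
    \<open>A\<close>; the conclusion is stated in the opposite direction.\<close>
  then have "?Z n Mod ?N \<cong> ?Z n' Mod ?M"
    by (rule group.iso_sym[OF normal.factorgroup_is_group[OF nB]])
  then show ?thesis using A B by (simp add: Ab_def)
qed

end
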